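(* Let $M$ be a helix hypersurface with the direction $d$ in $E^n$ and let $\alpha: I\subset\mathbb{R}\to M$ be a unit speed geodesic curve on $M$. Then the curve $\alpha$ is a $V_2$-slant helix with the direction $d$ in $E^n$.
   Context: $E^n$ is $\mathbb{R}^n$ with the standard scalar product $\langle\cdot,\cdot\rangle$. Helix hypersurface: given a hypersurface $M\subset\mathbb{R}^n$ and a unit vector $d\in\mathbb{R}^n$, $M$ is a helix with respect to the fixed direction $d$ if for each $q\in M$ the angle between $d$ and $T_qM$ is constant (the same for all $q$); equivalently, $\langle d,\xi\rangle$ is a constant function along $M$, where $\xi$ is a unit normal vector field on $M$. Frenet frame: for a unit speed curve $\alpha: I\to E^n$, $\{V_1(s),\dots,V_n(s)\}$ is the orthonormal moving frame along $\alpha$ with $V_1=\alpha'$ satisfying $V_1'=k_1V_2$, $V_i'=-k_{i-1}V_{i-1}+k_iV_{i+1}$ for $2\le i\le n-1$, and $V_n'=-k_{n-1}V_{n-1}$; the functions $k_i$ are the curvatures of $\alpha$. Slant helices: a unit speed curve with nonzero curvatures $k_i$ $(i=1,\dots,n-1)$ in $E^n$ is called a $V_n$-slant helix if its $n$-th Frenet vector field $V_n$ makes a constant angle $\varphi$ with a fixed direction $X$ (a unit vector), that is, $\langle V_n,X\rangle=\cos(\varphi)$ with $\varphi\neq\pi/2$ constant along the curve. A $V_2$-slant helix with the direction $d$ is understood in the same way, with the second Frenet vector field $V_2$ in place of $V_n$ and $X=d$.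
   Formalization: The geodesic is assumed to have a Frenet frame with nonzero curvatures (straight lines fail), and φ≠π/2 is claimed only if d is not tangent to M everywhere (helices on a cylinder with axis d give φ=π/2); that V_2 makes a constant angle with d is proved in all cases. *)

theory Defs
  imports "HOL-Analysis.Analysis"
begin

text \<open>Euclidean space \<open>E\<^sup>n\<close> is \<open>real ^ 'n\<close> with \<open>n = CARD('n)\<close>.\<close>

text \<open>Differentiability classes for real-valued functions on an open set \<open>U\<close>: \<open>f\<close> is of class
  \<open>C\<^sup>k\<^sup>+\<^sup>1\<close> iff it is differentiable and all its directional derivatives are of class \<open>C\<^sup>k\<close>.\<close>

primrec class_C :: "nat \<Rightarrow> (real ^ 'n) set \<Rightarrow> (real ^ 'n \<Rightarrow> real) \<Rightarrow> bool" where
  "class_C 0 U f \<longleftrightarrow> continuous_on U f"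
| "class_C (Suc k) U f \<longleftrightarrow>
     (\<exists>D. (\<forall>x\<in>U. (f has_derivative D x) (at x)) \<and> (\<forall>v. class_C k U (\<lambda>x. D x v)))"

definition smooth_fun_on :: "(real ^ 'n) set \<Rightarrow> (real ^ 'n \<Rightarrow> real) \<Rightarrow> bool" where
  "smooth_fun_on U f \<longleftrightarrow> (\<forall>k. class_C k U f)"

text \<open>Smooth embedded hypersurfaces, i.e. subsets that are locally regular level sets.\<close>

definition hypersurface :: "(real ^ 'n) set \<Rightarrow> bool" where
  "hypersurface M \<longleftrightarrow>
     (\<forall>q\<in>M. \<exists>U f. open U \<and> q \<in> U \<and> smooth_fun_on U f \<and>
        M \<inter> U = {x \<in> U. f x = 0} \<and>
        (\<forall>x\<in>M \<inter> U. \<exists>v. frechet_derivative f (at x) v \<noteq> 0))"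

text \<open>\<open>T\<^sub>qM\<close> is the set of initial velocities of curves in \<open>M\<close> issuing from \<open>q\<close>. Requiring
  differentiability only at the initial parameter gives the same set as requiring
  smooth curves when \<open>M\<close> is an embedded hypersurface.\<close>

definition tangent_space :: "(real ^ 'n) set \<Rightarrow> real ^ 'n \<Rightarrow> (real ^ 'n) set" where
  "tangent_space M q =
     {w. \<exists>c e. e > 0 \<and> c 0 = q \<and> (\<forall>t\<in>{-e<..<e::real}. c t \<in> M) \<and>
          (c has_vector_derivative w) (at 0)}"

definition vec_angle :: "real ^ 'n \<Rightarrow> real ^ 'n \<Rightarrow> real" where
  "vec_angle u w = arccos ((u \<bullet> w) / (norm u * norm w))"

text \<open>The angle between a nonzero vector and a nontrivial linear subspace is the least angle to a
  nonzero vector of the subspace; it lies in \<open>[0, \<pi>/2]\<close>.\<close>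

definition subspace_angle :: "real ^ 'n \<Rightarrow> (real ^ 'n) set \<Rightarrow> real" where
  "subspace_angle u W = Inf {vec_angle u w | w. w \<in> W \<and> w \<noteq> 0}"

definition helix_hypersurface :: "(real ^ 'n) set \<Rightarrow> real ^ 'n \<Rightarrow> bool" where
  "helix_hypersurface M d \<longleftrightarrow>
     hypersurface M \<and> norm d = 1 \<and>
     (\<exists>\<theta>. \<forall>q\<in>M. subspace_angle d (tangent_space M q) = \<theta>)"

text \<open>Curves are functions on \<open>real\<close> of which only the values on the parameter interval \<open>I\<close>
  matter; derivatives are taken within \<open>I\<close>, hence are one-sided at end points belonging to \<open>I\<close>.\<close>

definition param_interval :: "real set \<Rightarrow> bool" where
  "param_interval I \<longleftrightarrow> is_interval I \<and> interior I \<noteq> {}"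

definition unit_speed_curve :: "real set \<Rightarrow> (real \<Rightarrow> real ^ 'n) \<Rightarrow> bool" where
  "unit_speed_curve I \<alpha> \<longleftrightarrow>
     param_interval I \<and>
     (\<forall>s\<in>I. \<exists>v. (\<alpha> has_vector_derivative v) (at s within I) \<and> norm v = 1)"

text \<open>A geodesic of \<open>M\<close> is a curve in \<open>M\<close> whose covariant acceleration, the tangential component
  of \<open>\<alpha>''\<close>, vanishes.\<close>

definition geodesic_on :: "(real ^ 'n) set \<Rightarrow> real set \<Rightarrow> (real \<Rightarrow> real ^ 'n) \<Rightarrow> bool" where
  "geodesic_on M I \<alpha> \<longleftrightarrow>
     (\<forall>s\<in>I. \<alpha> s \<in> M) \<and>
     (\<exists>v a. (\<forall>s\<in>I. (\<alpha> has_vector_derivative v s) (at s within I)) \<and>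
            (\<forall>s\<in>I. (v has_vector_derivative a s) (at s within I)) \<and>
            (\<forall>s\<in>I. \<forall>w\<in>tangent_space M (\<alpha> s). a s \<bullet> w = 0))"

text \<open>\<open>V i\<close> for \<open>1 \<le> i \<le> n\<close> are the Frenet vector fields and \<open>k i\<close> for \<open>1 \<le> i \<le> n - 1\<close> the
  curvatures of \<open>\<alpha>\<close>; all other indices are irrelevant. Meaningful for \<open>n \<ge> 2\<close>.\<close>

definition frenet_frame ::
  "real set \<Rightarrow> (real \<Rightarrow> real ^ 'n) \<Rightarrow> (nat \<Rightarrow> real \<Rightarrow> real ^ 'n) \<Rightarrow> (nat \<Rightarrow> real \<Rightarrow> real) \<Rightarrow> bool" where
  "frenet_frame I \<alpha> V k \<longleftrightarrow>
     (\<forall>s\<in>I.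
        (\<forall>i\<in>{1..CARD('n)}. \<forall>j\<in>{1..CARD('n)}. V i s \<bullet> V j s = (if i = j then 1 else 0)) \<and>
        (\<alpha> has_vector_derivative V 1 s) (at s within I) \<and>
        (V 1 has_vector_derivative k 1 s *\<^sub>R V 2 s) (at s within I) \<and>
        (\<forall>i\<in>{2..CARD('n) - 1}.
           (V i has_vector_derivative
              - (k (i - 1) s *\<^sub>R V (i - 1) s) + k i s *\<^sub>R V (i + 1) s) (at s within I)) \<and>
        (V CARD('n) has_vector_derivative
           - (k (CARD('n) - 1) s *\<^sub>R V (CARD('n) - 1) s)) (at s within I))"

definition frenet_curve ::
  "real set \<Rightarrow> (real \<Rightarrow> real ^ 'n) \<Rightarrow> (nat \<Rightarrow> real \<Rightarrow> real ^ 'n) \<Rightarrow> (nat \<Rightarrow> real \<Rightarrow> real) \<Rightarrow> bool" where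
  "frenet_curve I \<alpha> V k \<longleftrightarrow>
     unit_speed_curve I \<alpha> \<and> frenet_frame I \<alpha> V k \<and>
     (\<forall>i\<in>{1..CARD('n) - 1}. \<forall>s\<in>I. k i s \<noteq> 0)"

definition constant_angle_with ::
  "real set \<Rightarrow> (real \<Rightarrow> real ^ 'n) \<Rightarrow> real ^ 'n \<Rightarrow> real \<Rightarrow> bool" where
  "constant_angle_with I W X \<phi> \<longleftrightarrow> \<phi> \<in> {0..pi} \<and> (\<forall>s\<in>I. W s \<bullet> X = cos \<phi>)"

text \<open>\<open>V\<^sub>j\<close>-slant helices with direction \<open>X\<close>. The angle ranges over \<open>[0, \<pi>]\<close>, so that
  \<open>\<phi> \<noteq> \<pi>/2\<close> says that \<open>V\<^sub>j\<close> and \<open>X\<close> are not orthogonal.\<close>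

definition slant_helix ::
  "nat \<Rightarrow> real set \<Rightarrow> (real \<Rightarrow> real ^ 'n) \<Rightarrow> (nat \<Rightarrow> real \<Rightarrow> real ^ 'n) \<Rightarrow> (nat \<Rightarrow> real \<Rightarrow> real) \<Rightarrow>
   real ^ 'n \<Rightarrow> bool" where
  "slant_helix j I \<alpha> V k X \<longleftrightarrow>
     frenet_curve I \<alpha> V k \<and> norm X = 1 \<and>
     (\<exists>\<phi>. \<phi> \<noteq> pi / 2 \<and> constant_angle_with I (V j) X \<phi>)"

end

theory Submission
  imports Defs
begin

text \<open>At each point the tangent space of a hypersurface is the hyperplane \<open>u\<^sup>\<bottom>\<close> for a unit normal
  \<open>u\<close>, and the angle between \<open>d\<close> and \<open>u\<^sup>\<bottom>\<close> has cosine \<open>sqrt (1 - (u \<bullet> d)\<^sup>2)\<close>; so on a helix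
  hypersurface \<open>(u \<bullet> d)\<^sup>2\<close> is constant. Along a geodesic \<open>\<alpha>'' = k\<^sub>1 V\<^sub>2\<close> is normal, so that \<open>V\<^sub>2\<close> is a
  unit normal and \<open>(V\<^sub>2 \<bullet> d)\<^sup>2\<close> is constant; by continuity \<open>V\<^sub>2 \<bullet> d\<close> has no sign change and is itself
  constant.\<close>

section \<open>Tangent spaces of regular level sets\<close>

text \<open>The intermediate value theorem on the segment of the \<open>r\<close> with \<open>\<bar>r\<bar> \<le> \<epsilon> \<bar>t\<bar>\<close> replaces the
  implicit function theorem.\<close>

lemma level_set_near_tangent_line:
  fixes f :: "'a::real_normed_vector \<Rightarrow> real"
  assumes U: "open U" "q \<in> U" and cont: "continuous_on U f" and "f q = 0"
    and L: "(f has_derivative L) (at q)" and "L w = 0" "L v = 1" and "\<epsilon> > 0"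
  shows "\<exists>\<delta>>0. \<forall>t. \<bar>t\<bar> < \<delta> \<longrightarrow>
           (\<exists>r. \<bar>r\<bar> \<le> \<epsilon> * \<bar>t\<bar> \<and> q + t *\<^sub>R w + r *\<^sub>R v \<in> U \<and> f (q + t *\<^sub>R w + r *\<^sub>R v) = 0)"
proof -
  interpret L: bounded_linear L using L by (rule has_derivative_bounded_linear)
  obtain \<rho> where \<rho>: "\<rho> > 0" "ball q \<rho> \<subseteq> U" using U open_contains_ball by blast
  \<comment> \<open>\<open>K\<close> is chosen so that
    \<open>norm (?h r - q) \<le> \<bar>t\<bar> * K\<close> on the segment; the precision
    \<open>\<epsilon> / K\<close> below then makes the linearisation error at most
    \<open>\<epsilon> * \<bar>t\<bar>\<close>.\<close>
  define K where "K = norm w + \<epsilon> * norm v + 1"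
  have K: "K > 0" using \<open>\<epsilon> > 0\<close> unfolding K_def by (simp add: add_nonneg_pos)
  obtain d where d: "d > 0"
    "\<And>y. norm (y - q) < d \<Longrightarrow> norm (f y - f q - L (y - q)) \<le> \<epsilon> / K * norm (y - q)"
    using L \<open>\<epsilon> > 0\<close> K unfolding has_derivative_at_alt by (metis divide_pos_pos)
  show ?thesis
  proof (rule exI[of _ "min d \<rho> / K"], intro conjI allI impI)
    show "min d \<rho> / K > 0" using d \<rho> K by simp
    fix t :: real assume t: "\<bar>t\<bar> < min d \<rho> / K"
    let ?h = "\<lambda>r. q + t *\<^sub>R w + r *\<^sub>R v"
    have dist: "norm (?h r - q) \<le> \<bar>t\<bar> * K" if "\<bar>r\<bar> \<le> \<epsilon> * \<bar>t\<bar>" for r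
    proof -
      have "norm (?h r - q) \<le> \<bar>t\<bar> * norm w + \<bar>r\<bar> * norm v"
        by (smt (verit) norm_triangle_ineq add.assoc add_diff_cancel_left' norm_scaleR)
      also have "\<dots> \<le> \<bar>t\<bar> * norm w + (\<epsilon> * \<bar>t\<bar>) * norm v"
        using that by (simp add: mult_right_mono)
      also have "\<dots> \<le> \<bar>t\<bar> * K" unfolding K_def by (simp add: algebra_simps)
      finally show ?thesis .
    qed
    have tK: "\<bar>t\<bar> * K < d" "\<bar>t\<bar> * K < \<rho>" using t K by (auto simp: field_simps)
    have inU: "?h r \<in> U" if "\<bar>r\<bar> \<le> \<epsilon> * \<bar>t\<bar>" for r
      using dist[OF that] tK \<rho> by (auto simp: dist_norm norm_minus_commute subset_iff)
    have est: "\<bar>f (?h r) - r\<bar> \<le> \<epsilon> * \<bar>t\<bar>" if "\<bar>r\<bar> \<le> \<epsilon> * \<bar>t\<bar>" for r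
    proof -
      have "L (?h r - q) = r"
        using \<open>L w = 0\<close> \<open>L v = 1\<close> by (simp add: L.add L.diff L.scaleR)
      then have "\<bar>f (?h r) - r\<bar> \<le> \<epsilon> / K * norm (?h r - q)"
        using d(2)[of "?h r"] dist[OF that] tK \<open>f q = 0\<close> by simp
      also have "\<dots> \<le> \<epsilon> / K * (\<bar>t\<bar> * K)"
        using dist[OF that] K \<open>\<epsilon> > 0\<close> by (intro mult_left_mono) auto
      finally show ?thesis using K by simp
    qed
    have "continuous_on {- (\<epsilon> * \<bar>t\<bar>)..\<epsilon> * \<bar>t\<bar>} (\<lambda>r. f (?h r))"
      by (rule continuous_on_compose2[OF cont]) (auto intro!: continuous_intros inU)
    \<comment> \<open>On the segment \<open>f (?h r)\<close> differs from \<open>r\<close> by at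
      most half its length, so the end points give opposite weak signs.\<close>
    moreover have "\<bar>f (?h (- (\<epsilon> * \<bar>t\<bar>))) - (- (\<epsilon> * \<bar>t\<bar>))\<bar> \<le> \<epsilon> * \<bar>t\<bar>"
      "\<bar>f (?h (\<epsilon> * \<bar>t\<bar>)) - \<epsilon> * \<bar>t\<bar>\<bar> \<le> \<epsilon> * \<bar>t\<bar>"
      by (rule est, use \<open>\<epsilon> > 0\<close> in \<open>simp add: abs_mult\<close>)+
    then have "f (?h (- (\<epsilon> * \<bar>t\<bar>))) \<le> 0" "0 \<le> f (?h (\<epsilon> * \<bar>t\<bar>))" by linarith+
    ultimately obtain r where "- (\<epsilon> * \<bar>t\<bar>) \<le> r" "r \<le> \<epsilon> * \<bar>t\<bar>" "f (?h r) = 0"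
      using IVT'[of "\<lambda>r. f (?h r)" "- (\<epsilon> * \<bar>t\<bar>)" 0 "\<epsilon> * \<bar>t\<bar>"] \<open>\<epsilon> > 0\<close> by auto
    then show "\<exists>r. \<bar>r\<bar> \<le> \<epsilon> * \<bar>t\<bar> \<and> ?h r \<in> U \<and> f (?h r) = 0"
      using inU by (intro exI[of _ r]) auto
  qed
qed

text \<open>Shifting \<open>q + t *\<^sub>R w\<close> by a correction \<open>r t *\<^sub>R v\<close>
  with \<open>r t = o(t)\<close> lands in the level set and keeps the velocity \<open>w\<close>.
  Differentiability is asked only at 0, so \<open>r t\<close> can be picked separately for each
  \<open>t\<close>.\<close>

lemma level_set_curve_in_kernel_direction:
  fixes f :: "'a::real_normed_vector \<Rightarrow> real"
  assumes U: "open U" "q \<in> U" and cont: "continuous_on U f" and "f q = 0"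
    and L: "(f has_derivative L) (at q)" and "L w = 0" "L u \<noteq> 0"
  shows "\<exists>c e. e > 0 \<and> c 0 = q \<and> (\<forall>t\<in>{-e<..<e::real}. c t \<in> U \<and> f (c t) = 0) \<and>
           (c has_vector_derivative w) (at 0)"
proof -
  interpret L: bounded_linear L using L by (rule has_derivative_bounded_linear)
  define v where "v = u /\<^sub>R L u"
  have "L v = 1" using \<open>L u \<noteq> 0\<close> by (simp add: v_def L.scaleR)
  note near = level_set_near_tangent_line[OF U cont \<open>f q = 0\<close> L \<open>L w = 0\<close> \<open>L v = 1\<close>]
  define S where "S t = {r. q + t *\<^sub>R w + r *\<^sub>R v \<in> U \<and> f (q + t *\<^sub>R w + r *\<^sub>R v) = 0}" for t
  \<comment> \<open>An almost smallest root works for every \<open>\<epsilon>\<close> at once; the slack \<open>t\<^sup>2\<close> forces the root 0 at \<open>t = 0\<close>.\<close>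
  have "\<exists>r\<in>S t. \<forall>r'\<in>S t. \<bar>r\<bar> \<le> \<bar>r'\<bar> + t\<^sup>2" if "S t \<noteq> {}" for t
  proof (cases "t = 0")
    case True
    have "0 \<in> S 0" using U \<open>f q = 0\<close> by (simp add: S_def)
    then show ?thesis using True by (auto intro!: bexI[of _ 0])
  next
    case False
    let ?i = "Inf (abs ` S t)"
    have bdd: "bdd_below (abs ` S t)" by (intro bdd_belowI[of _ 0]) auto
    have "?i < ?i + t\<^sup>2" using False by simp
    then obtain r where r: "r \<in> S t" "\<bar>r\<bar> < ?i + t\<^sup>2"
      using cInf_lessD[of "abs ` S t" "?i + t\<^sup>2"] \<open>S t \<noteq> {}\<close> by auto
    have "?i \<le> \<bar>r'\<bar>" if "r' \<in> S t" for r'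
      using cInf_lower[OF _ bdd] that by auto
    then show ?thesis using r by force
  qed
  then obtain r where r: "\<And>t. S t \<noteq> {} \<Longrightarrow> r t \<in> S t"
    and rmin: "\<And>t r'. r' \<in> S t \<Longrightarrow> \<bar>r t\<bar> \<le> \<bar>r'\<bar> + t\<^sup>2"
    by (metis empty_iff)
  \<comment> \<open>Some root has size at most \<open>\<epsilon> * \<bar>t\<bar>\<close>, and the
    slack satisfies \<open>t\<^sup>2 \<le> \<epsilon> * \<bar>t\<bar>\<close> once
    \<open>\<bar>t\<bar> < \<epsilon>\<close>; hence the factor 2.\<close>
  have small: "\<exists>\<delta>>0. \<forall>t. \<bar>t\<bar> < \<delta> \<longrightarrow> r t \<in> S t \<and> \<bar>r t\<bar> \<le> 2 * \<epsilon> * \<bar>t\<bar>" if \<epsilon>: "\<epsilon> > 0" for \<epsilon>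
  proof -
    obtain \<delta> where \<delta>: "\<delta> > 0" "\<And>t. \<bar>t\<bar> < \<delta> \<Longrightarrow> \<exists>r'\<in>S t. \<bar>r'\<bar> \<le> \<epsilon> * \<bar>t\<bar>"
      using near[OF \<epsilon>] unfolding S_def by blast
    have "r t \<in> S t \<and> \<bar>r t\<bar> \<le> 2 * \<epsilon> * \<bar>t\<bar>" if "\<bar>t\<bar> < min \<delta> \<epsilon>" for t
    proof -
      obtain r' where r': "r' \<in> S t" "\<bar>r'\<bar> \<le> \<epsilon> * \<bar>t\<bar>"
        using \<delta>(2) \<open>\<bar>t\<bar> < min \<delta> \<epsilon>\<close> by (metis min_less_iff_conj)
      have "\<bar>t\<bar> * \<bar>t\<bar> \<le> \<epsilon> * \<bar>t\<bar>" using that by (intro mult_right_mono) auto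
      then have "\<bar>r t\<bar> \<le> 2 * \<epsilon> * \<bar>t\<bar>"
        using rmin[OF r'(1)] r'(2) by (simp add: power2_eq_square)
      then show ?thesis using r r'(1) by blast
    qed
    then show ?thesis using \<delta>(1) \<epsilon> by (intro exI[of _ "min \<delta> \<epsilon>"]) auto
  qed
  define c where "c t = q + t *\<^sub>R w + r t *\<^sub>R v" for t
  \<comment> \<open>Precision 1 fixes the parameter interval; its bound at \<open>t = 0\<close>
    gives \<open>r 0 = 0\<close>.\<close>
  obtain e where e: "e > 0" "\<And>t. \<bar>t\<bar> < e \<Longrightarrow> r t \<in> S t"
    and r_le: "\<And>t. \<bar>t\<bar> < e \<Longrightarrow> \<bar>r t\<bar> \<le> 2 * 1 * \<bar>t\<bar>"
    using small[OF zero_less_one] by blast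
  have "r 0 = 0" using r_le[of 0] e(1) by simp
  then have c0: "c 0 = q" by (simp add: c_def)
  have "(c has_derivative (\<lambda>t. t *\<^sub>R w)) (at 0)"
    unfolding has_derivative_at_alt
  proof (intro conjI allI impI)
    show "bounded_linear (\<lambda>t. t *\<^sub>R w)" by (rule bounded_linear_scaleR_left)
    fix \<epsilon> :: real assume "\<epsilon> > 0"
    \<comment> \<open>The displacement from the line is \<open>\<bar>r t\<bar> * norm v\<close>, at
      most \<open>2 * \<eta> * \<bar>t\<bar> * norm v\<close>; the \<open>+ 1\<close> keeps the
      denominator positive.\<close>
    define \<eta> where "\<eta> = \<epsilon> / (2 * (norm v + 1))"
    have "norm v + 1 > 0" by (simp add: add_nonneg_pos)
    then have \<eta>: "\<eta> > 0" "2 * \<eta> * (norm v + 1) = \<epsilon>"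
      using \<open>\<epsilon> > 0\<close> by (auto simp: \<eta>_def field_simps)
    obtain \<delta> where \<delta>: "\<delta> > 0" "\<And>t. \<bar>t\<bar> < \<delta> \<Longrightarrow> \<bar>r t\<bar> \<le> 2 * \<eta> * \<bar>t\<bar>"
      using small[OF \<eta>(1)] by blast
    have "norm (c t - c 0 - (t - 0) *\<^sub>R w) \<le> \<epsilon> * norm (t - 0)" if "\<bar>t\<bar> < \<delta>" for t
    proof -
      have "norm (c t - c 0 - (t - 0) *\<^sub>R w) = \<bar>r t\<bar> * norm v"
        unfolding c0 by (simp add: c_def)
      also have "\<dots> \<le> 2 * \<eta> * \<bar>t\<bar> * (norm v + 1)"
        using \<delta>(2)[OF that] \<eta>(1) by (intro mult_mono) auto
      also have "\<dots> = \<epsilon> * norm (t - 0)" using \<eta>(2) by (simp add: mult_ac)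
      finally show ?thesis .
    qed
    then show "\<exists>d>0. \<forall>t. norm (t - 0) < d \<longrightarrow>
        norm (c t - c 0 - (t - 0) *\<^sub>R w) \<le> \<epsilon> * norm (t - 0)"
      using \<delta>(1) by auto
  qed
  moreover have "\<forall>t\<in>{-e<..<e}. c t \<in> U \<and> f (c t) = 0"
    using e(2) by (auto simp: S_def c_def)
  ultimately show ?thesis using c0 e(1) unfolding has_vector_derivative_def by blast
qed

text \<open>A velocity lies in the kernel by the chain rule, since \<open>f\<close> vanishes along
  the curve; the converse is the curve just constructed.\<close>

lemma tangent_space_level_set:
  fixes M :: "(real ^ 'n) set" and f :: "real ^ 'n \<Rightarrow> real"
  assumes U: "open U" "q \<in> U" and cont: "continuous_on U f" and "q \<in> M"
    and MU: "M \<inter> U = {x \<in> U. f x = 0}"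
    and L: "(f has_derivative L) (at q)" and "L u \<noteq> 0"
  shows "tangent_space M q = {w. L w = 0}"
proof (intro equalityI subsetI CollectI)
  fix w assume "w \<in> tangent_space M q"
  then obtain c e where e: "e > 0" and c0: "c 0 = q" and cM: "\<forall>t\<in>{-e<..<e::real}. c t \<in> M"
    and c: "(c has_vector_derivative w) (at 0)"
    unfolding tangent_space_def by blast
  have "isCont c 0" using c has_vector_derivative_continuous by blast
  then have "\<forall>\<^sub>F t in nhds 0. c t \<in> U"
    using U c0 by (simp add: eventually_nhds_conv_at isCont_def tendsto_def)
  moreover have "\<forall>\<^sub>F t in nhds (0::real). t \<in> {-e<..<e}"
    using e by (intro eventually_nhds_in_open) auto
  ultimately have ev: "\<forall>\<^sub>F t in nhds 0. f (c t) = 0"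
    by eventually_elim (use cM MU in blast)
  have "((\<lambda>t. f (c t)) has_derivative (\<lambda>t. L (t *\<^sub>R w))) (at 0)"
    using has_derivative_compose[of c "\<lambda>t. t *\<^sub>R w" 0 UNIV f L] c L c0
    by (simp add: has_vector_derivative_def)
  \<comment> \<open>Continuity keeps \<open>c t\<close> in \<open>U\<close> for small
    \<open>t\<close>, so the composite is locally the zero function.\<close>
  then have "((\<lambda>t::real. 0) has_derivative (\<lambda>t. L (t *\<^sub>R w))) (at 0)"
    by (rule has_derivative_transform_eventually)
      (use ev in \<open>auto simp: eventually_nhds_conv_at\<close>)
  then have "(\<lambda>t. L (t *\<^sub>R w)) = (\<lambda>t. 0)"
    using has_derivative_unique has_derivative_const by blast
  from fun_cong[OF this, of 1] show "L w = 0" by simp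
next
  fix w assume "w \<in> {w. L w = 0}"
  moreover have "f q = 0" using MU U \<open>q \<in> M\<close> by blast
  ultimately show "w \<in> tangent_space M q"
    using level_set_curve_in_kernel_direction[OF U cont _ L _ \<open>L u \<noteq> 0\<close>, of w] MU
    unfolding tangent_space_def by blast
qed

text \<open>The normal is the normalised gradient of a local defining function.\<close>

lemma hypersurface_unit_normal:
  fixes M :: "(real ^ 'n) set"
  assumes "hypersurface M" "q \<in> M"
  obtains u where "norm u = 1" "tangent_space M q = {w. u \<bullet> w = 0}"
proof -
  obtain U f where U: "open U" "q \<in> U" and f: "smooth_fun_on U f"
    and MU: "M \<inter> U = {x \<in> U. f x = 0}"
    and reg: "\<forall>x\<in>M \<inter> U. \<exists>v. frechet_derivative f (at x) v \<noteq> 0"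
    using bspec[OF assms(1)[unfolded hypersurface_def] assms(2)] by (elim exE conjE)
  obtain u where u: "frechet_derivative f (at q) u \<noteq> 0"
    using bspec[OF reg] U(2) assms(2) by blast
  have cont: "continuous_on U f"
    using f unfolding smooth_fun_on_def by (metis class_C.simps(1))
  obtain D where D: "(f has_derivative D) (at q)"
    using f U(2) unfolding smooth_fun_on_def by (metis class_C.simps(2))
  then have "D u \<noteq> 0" using u frechet_derivative_at by metis
  interpret D: bounded_linear D using D by (rule has_derivative_bounded_linear)
  \<comment> \<open>\<open>g\<close> is the gradient of \<open>f\<close> at \<open>q\<close>, the
    vector representing \<open>D\<close>.\<close>
  define g where "g = (\<Sum>b\<in>Basis. D b *\<^sub>R b)"
  have g: "D x = g \<bullet> x" for x
  proof -
    have "D x = D (\<Sum>b\<in>Basis. (x \<bullet> b) *\<^sub>R b)" by (simp add: euclidean_representation)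
    then show ?thesis
      by (simp add: D.sum D.scaleR g_def inner_sum_left inner_commute[of x] mult.commute)
  qed
  have "g \<noteq> 0" using g \<open>D u \<noteq> 0\<close> by auto
  have "tangent_space M q = {w. (g /\<^sub>R norm g) \<bullet> w = 0}"
    using tangent_space_level_set[OF U cont assms(2) MU D \<open>D u \<noteq> 0\<close>] \<open>g \<noteq> 0\<close> by (simp add: g)
  then show ?thesis using that[of "g /\<^sub>R norm g"] \<open>g \<noteq> 0\<close> by simp
qed

section \<open>Unit normals of hyperplanes and the angle with a hyperplane\<close>

lemma unit_vector_orthogonal_to_hyperplane:
  fixes u v :: "'a::real_inner"
  assumes "norm u = 1" "norm v = 1" and orth: "\<And>w. u \<bullet> w = 0 \<Longrightarrow> v \<bullet> w = 0"
  shows "v = u \<or> v = - u"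
proof -
  have uu: "u \<bullet> u = 1" using assms by (simp add: norm_eq_1)
  \<comment> \<open>The part of \<open>v\<close> orthogonal to \<open>u\<close>; it is orthogonal to
    both \<open>u\<close> and \<open>v\<close>, hence to itself.\<close>
  let ?w = "v - (u \<bullet> v) *\<^sub>R u"
  have "u \<bullet> ?w = 0" using uu by (simp add: inner_diff_right)
  then have "?w \<bullet> ?w = 0" using orth[of ?w] by (simp add: inner_diff_left)
  then have v: "v = (u \<bullet> v) *\<^sub>R u" by simp
  then have "\<bar>u \<bullet> v\<bar> = 1" using assms by (metis norm_scaleR mult.right_neutral)
  then show ?thesis using v by (metis abs_minus_commute abs_eq_iff' abs_1 scaleR_one scaleR_minus1_left)
qed

text \<open>With \<open>p\<close> the orthogonal projection of \<open>d\<close> to the hyperplane,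
  \<open>d \<bullet> w = p \<bullet> w\<close> there, so Cauchy-Schwarz bounds the cosine by
  \<open>norm p\<close>, with equality at \<open>w = p\<close>.\<close>

lemma subspace_angle_hyperplane:
  fixes u d :: "real ^ 'n"
  assumes "CARD('n) \<ge> 2" and "norm u = 1" "norm d = 1"
  shows "subspace_angle d {w. u \<bullet> w = 0} = arccos (sqrt (1 - (u \<bullet> d)\<^sup>2))"
proof -
  have uu: "u \<bullet> u = 1" and dd: "d \<bullet> d = 1" using assms by (auto simp: norm_eq_1)
  define p where "p = d - (u \<bullet> d) *\<^sub>R u"
  have pu: "u \<bullet> p = 0" using uu by (simp add: p_def inner_diff_right)
  have dw: "d \<bullet> w = p \<bullet> w" if "u \<bullet> w = 0" for w
    using that by (simp add: p_def inner_diff_left)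
  have "p \<bullet> p = d \<bullet> p" using dw[OF pu] by simp
  also have "\<dots> = 1 - (u \<bullet> d)\<^sup>2"
    by (simp add: p_def inner_diff_right dd power2_eq_square inner_commute)
  finally have np: "norm p = sqrt (1 - (u \<bullet> d)\<^sup>2)" by (simp add: norm_eq_sqrt_inner)
  have p1: "norm p \<le> 1" unfolding np by (simp add: real_le_lsqrt)
  have "\<exists>w. u \<bullet> w = 0 \<and> w \<noteq> 0 \<and> vec_angle d w = arccos (norm p)"
  proof (cases "p = 0")
    \<comment> \<open>Here \<open>d\<close> is normal to the hyperplane and every nonzero
      \<open>w\<close> in it attains the angle \<open>arccos 0\<close>; dimension at least 2
      provides one.\<close>
    case True
    obtain w where "w \<noteq> 0" "orthogonal u w"
      using orthogonal_to_vector_exists[of u] assms(1) by auto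
    then show ?thesis using True dw[of w]
      by (intro exI[of _ w]) (auto simp: orthogonal_def vec_angle_def)
  next
    case False
    then have "d \<bullet> p / (norm d * norm p) = norm p"
      using dw[OF pu] assms by (simp add: dot_square_norm power2_eq_square)
    then show ?thesis using False pu by (intro exI[of _ p]) (simp add: vec_angle_def)
  qed
  moreover have "arccos (norm p) \<le> vec_angle d w" if w: "u \<bullet> w = 0" "w \<noteq> 0" for w
  proof -
    have "\<bar>p \<bullet> w\<bar> \<le> norm p * norm w" by (rule Cauchy_Schwarz_ineq2)
    then have "\<bar>d \<bullet> w / (norm d * norm w)\<bar> \<le> norm p"
      using w dw[OF w(1)] assms by (simp add: abs_mult field_simps)
    then have "- 1 \<le> d \<bullet> w / (norm d * norm w)" "d \<bullet> w / (norm d * norm w) \<le> norm p"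
      using p1 by linarith+
    then show ?thesis unfolding vec_angle_def using p1 by (intro arccos_le_arccos)
  qed
  ultimately show ?thesis unfolding subspace_angle_def np[symmetric]
    by (intro cInf_eq_minimum) force+
qed

section \<open>Constant squares on intervals and Frenet frames along geodesics\<close>

text \<open>Distinct values would be opposite, so 0 would lie between them and be attained, forcing
  \<open>b = 0\<close> and both values to vanish.\<close>

lemma continuous_on_interval_constant_square:
  fixes g :: "real \<Rightarrow> real"
  assumes "is_interval I" "continuous_on I g" and sq: "\<And>s. s \<in> I \<Longrightarrow> (g s)\<^sup>2 = b"
    and "s \<in> I" "t \<in> I"
  shows "g s = g t"
proof (rule ccontr)
  assume neq: "g s \<noteq> g t"
  have "(g s)\<^sup>2 = (g t)\<^sup>2" using sq assms by simp
  then have neg: "g t = - g s" using neq by (auto simp: power2_eq_iff)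
  have "is_interval (g ` I)"
    using assms by (simp add: is_interval_connected_1 connected_continuous_image)
  moreover have "g s \<in> g ` I" "g t \<in> g ` I" using assms by auto
  ultimately have "0 \<in> g ` I"
    using neg unfolding is_interval_1 by (metis neg_0_le_iff_le neg_le_0_iff_le linear)
  then have "b = 0" using sq by force
  then show False using sq[OF \<open>s \<in> I\<close>] sq[OF \<open>t \<in> I\<close>] neq by simp
qed

text \<open>This makes derivatives within \<open>I\<close> unique, also at end points: a connected
  set with more than one point has no isolated point.\<close>

lemma param_interval_at_within_neq_bot:
  assumes "param_interval I" "s \<in> I"
  shows "at s within I \<noteq> bot"
proof -
  have "connected I" "interior I \<noteq> {}"
    using assms by (auto simp: param_interval_def is_interval_connected_1)
  moreover have "I \<noteq> {x}" for x using \<open>interior I \<noteq> {}\<close> by auto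
  ultimately show ?thesis
    using connected_imp_perfect[of I s] assms(2) by (simp add: trivial_limit_within)
qed

text \<open>Uniqueness of derivatives identifies the normal acceleration \<open>a s\<close> with
  \<open>k 1 s *\<^sub>R V 2 s\<close>, and the nonzero curvature can be cancelled.\<close>

lemma geodesic_second_frenet_normal:
  fixes M :: "(real ^ 'n) set"
  assumes "CARD('n) \<ge> 2" and fr: "frenet_curve I \<alpha> V k" and geo: "geodesic_on M I \<alpha>"
    and "s \<in> I" and w: "w \<in> tangent_space M (\<alpha> s)"
  shows "V 2 s \<bullet> w = 0"
proof -
  have pI: "param_interval I" using fr by (simp add: frenet_curve_def unit_speed_curve_def)
  obtain v a where v: "\<And>s. s \<in> I \<Longrightarrow> (\<alpha> has_vector_derivative v s) (at s within I)"
    and a: "\<And>s. s \<in> I \<Longrightarrow> (v has_vector_derivative a s) (at s within I)"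
    and orth: "\<And>s w. s \<in> I \<Longrightarrow> w \<in> tangent_space M (\<alpha> s) \<Longrightarrow> a s \<bullet> w = 0"
    using geo unfolding geodesic_on_def by blast
  note unique = vector_derivative_unique_within[OF param_interval_at_within_neq_bot[OF pI]]
  have V: "(\<alpha> has_vector_derivative V 1 s) (at s within I)"
    "(V 1 has_vector_derivative k 1 s *\<^sub>R V 2 s) (at s within I)" if "s \<in> I" for s
    using fr that unfolding frenet_curve_def frenet_frame_def by blast+
  have vV: "v s = V 1 s" if "s \<in> I" for s
    using unique[OF that v[OF that] V(1)[OF that]] .
  have "(v has_vector_derivative k 1 s *\<^sub>R V 2 s) (at s within I)"
    using has_vector_derivative_transform[OF \<open>s \<in> I\<close> vV V(2)[OF \<open>s \<in> I\<close>]] by simp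
  then have "a s = k 1 s *\<^sub>R V 2 s" using unique a \<open>s \<in> I\<close> by blast
  moreover have "k 1 s \<noteq> 0" using fr assms(1) \<open>s \<in> I\<close> unfolding frenet_curve_def by auto
  ultimately show ?thesis using orth[OF \<open>s \<in> I\<close> w] by simp
qed

lemma frenet_frame_continuous_second:
  fixes V :: "nat \<Rightarrow> real \<Rightarrow> real ^ 'n"
  assumes "CARD('n) \<ge> 2" and fr: "frenet_frame I \<alpha> V k"
  shows "continuous_on I (V 2)"
  unfolding continuous_on_eq_continuous_within
proof
  fix s assume "s \<in> I"
  then have F: "\<forall>i\<in>{2..CARD('n) - 1}. \<exists>D. (V i has_vector_derivative D) (at s within I)"
    "\<exists>D. (V CARD('n) has_vector_derivative D) (at s within I)"
    using fr unfolding frenet_frame_def by blast+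
  have "\<exists>D. (V 2 has_vector_derivative D) (at s within I)"
  \<comment> \<open>For \<open>n = 2\<close> the derivative of \<open>V 2\<close> comes from the
    last Frenet equation, otherwise from a middle one.\<close>
  proof (cases "CARD('n) = 2")
    case True
    then show ?thesis using F(2) by simp
  next
    case False
    then show ?thesis using F(1) assms(1) by simp
  qed
  then show "continuous (at s within I) (V 2)" using has_vector_derivative_continuous by blast
qed

section \<open>Constancy of the angle between \<open>V 2\<close> and \<open>d\<close> along the
  geodesic\<close>

theorem theorem3p1:
  fixes M :: "(real ^ 'n) set" and d :: "real ^ 'n"
    and I :: "real set" and \<alpha> :: "real \<Rightarrow> real ^ 'n"
    and V :: "nat \<Rightarrow> real \<Rightarrow> real ^ 'n" and k :: "nat \<Rightarrow> real \<Rightarrow> real"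
  assumes "CARD('n) \<ge> 2"
    and "helix_hypersurface M d"
    and "unit_speed_curve I \<alpha>"
    and "geodesic_on M I \<alpha>"
    and "frenet_curve I \<alpha> V k"
  shows "(\<exists>\<phi>. constant_angle_with I (V 2) d \<phi>) \<and>
         ((\<exists>q\<in>M. d \<notin> tangent_space M q) \<longrightarrow> slant_helix 2 I \<alpha> V k d)"
proof -
  obtain \<theta> where hyp: "hypersurface M" and nd: "norm d = 1"
    and \<theta>: "\<And>q. q \<in> M \<Longrightarrow> subspace_angle d (tangent_space M q) = \<theta>"
    using assms(2) unfolding helix_hypersurface_def by blast
  \<comment> \<open>The angle with the hyperplane determines the normal component of
    \<open>d\<close> only up to sign, hence the square.\<close>
  have normal_sq: "(u \<bullet> d)\<^sup>2 = 1 - (cos \<theta>)\<^sup>2"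
    if "q \<in> M" "norm u = 1" "tangent_space M q = {w. u \<bullet> w = 0}" for q u
  proof -
    have "\<theta> = arccos (sqrt (1 - (u \<bullet> d)\<^sup>2))"
      using \<theta>[OF that(1)] subspace_angle_hyperplane[OF assms(1) that(2) nd] that(3) by simp
    moreover have "\<bar>u \<bullet> d\<bar> \<le> 1" using Cauchy_Schwarz_ineq2[of u d] that(2) nd by simp
    then have "0 \<le> 1 - (u \<bullet> d)\<^sup>2" by (simp add: abs_square_le_1)
    ultimately show ?thesis by (simp add: cos_arccos_abs)
  qed
  have fr: "frenet_frame I \<alpha> V k" and pI: "param_interval I"
    using assms(3,5) by (auto simp: frenet_curve_def unit_speed_curve_def)
  have V2_norm: "norm (V 2 s) = 1" if "s \<in> I" for s
  proof -
    have "V 2 s \<bullet> V 2 s = 1" using fr that assms(1) unfolding frenet_frame_def by auto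
    then show ?thesis by (simp add: norm_eq_1)
  qed
  have V2_sq: "(V 2 s \<bullet> d)\<^sup>2 = 1 - (cos \<theta>)\<^sup>2" if "s \<in> I" for s
  proof -
    have "\<alpha> s \<in> M" using assms(4) that unfolding geodesic_on_def by blast
    then obtain u where u: "norm u = 1" "tangent_space M (\<alpha> s) = {w. u \<bullet> w = 0}"
      using hypersurface_unit_normal[OF hyp] by blast
    have "V 2 s = u \<or> V 2 s = - u"
      using geodesic_second_frenet_normal[OF assms(1,5,4) that] u V2_norm[OF that]
      by (intro unit_vector_orthogonal_to_hyperplane) auto
    then show ?thesis using normal_sq[OF \<open>\<alpha> s \<in> M\<close> u] by auto
  qed
  obtain s0 where s0: "s0 \<in> I"
    using pI interior_subset unfolding param_interval_def by blast
  have const: "V 2 s \<bullet> d = V 2 s0 \<bullet> d" if "s \<in> I" for s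
    using pI frenet_frame_continuous_second[OF assms(1) fr] V2_sq that s0
    unfolding param_interval_def
    by (intro continuous_on_interval_constant_square[of I "\<lambda>s. V 2 s \<bullet> d"])
      (auto intro!: continuous_intros)
  define \<phi> where "\<phi> = arccos (V 2 s0 \<bullet> d)"
  have "\<bar>V 2 s0 \<bullet> d\<bar> \<le> 1"
    using Cauchy_Schwarz_ineq2[of "V 2 s0" d] V2_norm[OF s0] nd by simp
  then have \<phi>: "cos \<phi> = V 2 s0 \<bullet> d" "\<phi> \<in> {0..pi}"
    by (auto simp: \<phi>_def cos_arccos_abs arccos_lbound arccos_ubound abs_le_iff)
  have ca: "constant_angle_with I (V 2) d \<phi>"
    unfolding constant_angle_with_def using \<phi> const by simp
  \<comment> \<open>The point \<open>q\<close> may lie off the curve: as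
    \<open>(u \<bullet> d)\<^sup>2\<close> is the same at all points of \<open>M\<close>, being
    nonzero at \<open>q\<close> carries over to \<open>V 2 s0\<close>.\<close>
  moreover have "slant_helix 2 I \<alpha> V k d" if q: "q \<in> M" "d \<notin> tangent_space M q" for q
  proof -
    obtain u where u: "norm u = 1" "tangent_space M q = {w. u \<bullet> w = 0}"
      using hypersurface_unit_normal[OF hyp q(1)] by blast
    have "u \<bullet> d \<noteq> 0" using q(2) u(2) by simp
    then have "V 2 s0 \<bullet> d \<noteq> 0" using V2_sq[OF s0] normal_sq[OF q(1) u] by auto
    then have "\<phi> \<noteq> pi / 2" using \<phi>(1) cos_pi_half by metis
    then show ?thesis unfolding slant_helix_def using assms(5) nd ca by blast
  qed
  ultimately show ?thesis by blast
qed

end
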